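(* Let $f:\Theta\to Z$ be an SCF with $|f(\Theta)|\ge 2$. The following are equivalent: (i) $f$ is pure-Nash-implementable; (ii) $f$ is mixed-Nash-implementable; (iii) $f$ is double-Nash-implementable; (iv) $\widehat{\mathcal L}^Y$-monotonicity holds.
   Context: Standing setup: $\mathcal I=\{1,\dots,I\}$ finite, $I\ge 3$; $\Theta$ finite or countably infinite; $Z$ finite; $Y=\Delta(Z)$ with $z\in Z$ identified with degenerate lotteries; $u_i^\theta:Z\to\mathbb R$, $U_i^\theta(y)=\sum_z y_zu_i^\theta(z)$; $\mathcal L_i^Y(\alpha,\theta)=\{y\in Y:U_i^\theta(\alpha)\ge U_i^\theta(y)\}$, $\mathcal L_i^Z(\alpha,\theta)=\{z\in Z:U_i^\theta(\alpha)\ge u_i^\theta(z)\}$. A mechanism $\mathcal M=\langle M=\times_iM_i,g:M\to Y\rangle$ has countable $M_i$; $g(\lambda)$ is the lottery induced by a profile $\lambda$; $PNE^{(\mathcal M,\theta)}$, $MNE^{(\mathcal M,\theta)}$ are the pure and mixed Nash equilibria at $\theta$ (w.r.t. $U_i^\theta$). $f$ is mixed-Nash-implementable (resp. pure-Nash-implementable) if there is $\mathcal M$ with $\bigcup_{\lambda\in MNE^{(\mathcal M,\theta)}}\mathrm{SUPP}(g[\lambda])=\{f(\theta)\}$ (resp. with $PNE$ in place of $MNE$) for all $\theta$; double-Nash-implementable if there is $\mathcal M$ with both unions (over $MNE$ and over $PNE$) equal to $\{f(\theta)\}$ for all $\theta$. A nonempty $E\subseteq Z$ is an $i$-$\theta$-max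 set if $E\subseteq\arg\max_{z\in E}u_i^\theta(z)$ and $E\subseteq\arg\max_{z\in Z}u_j^\theta(z)$ for all $j\ne i$; an $i$-max set if it is such for some $\theta$. $\widehat{\mathcal L}_i^Y(a,\theta)=\{a\}$ if $a=f(\theta)\in\arg\min_{z\in Z}u_i^\theta(z)$ and $\mathcal L_i^Z(f(\theta),\theta)$ is an $i$-max set; otherwise $\mathcal L_i^Y(a,\theta)$. $\widehat{\mathcal L}^Y$-monotonicity: for all $\theta,\theta'$, [$\widehat{\mathcal L}_i^Y(f(\theta),\theta)\subseteq\mathcal L_i^Y(f(\theta),\theta')$ for all $i$] implies $f(\theta)=f(\theta')$. *)

theory Defs
  imports "HOL-Probability.Probability"
begin

text \<open>Agents: a finite type 'i. States: a countable type 'th. Outcomes: a finite type 'z.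
  Lotteries Y = Delta(Z) are 'z pmf; z is identified with return_pmf z.
  Message spaces M i are (countable) subsets of nat; a mechanism is a pair (M, g)
  with g mapping message profiles ('i => nat) to lotteries.\<close>

definition EU :: "('i \<Rightarrow> 'th \<Rightarrow> 'z::finite \<Rightarrow> real) \<Rightarrow> 'i \<Rightarrow> 'th \<Rightarrow> 'z pmf \<Rightarrow> real" where
  "EU u i \<theta> y = (\<Sum>z\<in>UNIV. pmf y z * u i \<theta> z)"

definition lower_Y :: "('i \<Rightarrow> 'th \<Rightarrow> 'z::finite \<Rightarrow> real) \<Rightarrow> 'i \<Rightarrow> 'z pmf \<Rightarrow> 'th \<Rightarrow> 'z pmf set" where
  "lower_Y u i \<alpha> \<theta> = {y. EU u i \<theta> \<alpha> \<ge> EU u i \<theta> y}"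

definition lower_Z :: "('i \<Rightarrow> 'th \<Rightarrow> 'z::finite \<Rightarrow> real) \<Rightarrow> 'i \<Rightarrow> 'z pmf \<Rightarrow> 'th \<Rightarrow> 'z set" where
  "lower_Z u i \<alpha> \<theta> = {z. EU u i \<theta> \<alpha> \<ge> u i \<theta> z}"

definition argmax_on :: "('z \<Rightarrow> real) \<Rightarrow> 'z set \<Rightarrow> 'z set" where
  "argmax_on h S = {z \<in> S. \<forall>z'\<in>S. h z' \<le> h z}"

definition argmin_on :: "('z \<Rightarrow> real) \<Rightarrow> 'z set \<Rightarrow> 'z set" where
  "argmin_on h S = {z \<in> S. \<forall>z'\<in>S. h z \<le> h z'}"

definition is_i_theta_max :: "('i \<Rightarrow> 'th \<Rightarrow> 'z \<Rightarrow> real) \<Rightarrow> 'i \<Rightarrow> 'th \<Rightarrow> 'z set \<Rightarrow> bool" where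
  "is_i_theta_max u i \<theta> E \<longleftrightarrow>
     E \<noteq> {} \<and> E \<subseteq> argmax_on (u i \<theta>) E \<and> (\<forall>j. j \<noteq> i \<longrightarrow> E \<subseteq> argmax_on (u j \<theta>) UNIV)"

definition is_i_max :: "('i \<Rightarrow> 'th \<Rightarrow> 'z \<Rightarrow> real) \<Rightarrow> 'i \<Rightarrow> 'z set \<Rightarrow> bool" where
  "is_i_max u i E \<longleftrightarrow> (\<exists>\<theta>. is_i_theta_max u i \<theta> E)"

definition hatL_Y :: "('i \<Rightarrow> 'th \<Rightarrow> 'z::finite \<Rightarrow> real) \<Rightarrow> ('th \<Rightarrow> 'z) \<Rightarrow> 'i \<Rightarrow> 'z \<Rightarrow> 'th \<Rightarrow> 'z pmf set" where
  "hatL_Y u f i a \<theta> =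
     (if a = f \<theta> \<and> a \<in> argmin_on (u i \<theta>) UNIV \<and> is_i_max u i (lower_Z u i (return_pmf (f \<theta>)) \<theta>)
      then {return_pmf a} else lower_Y u i (return_pmf a) \<theta>)"

definition hatLY_monotone :: "('i \<Rightarrow> 'th \<Rightarrow> 'z::finite \<Rightarrow> real) \<Rightarrow> ('th \<Rightarrow> 'z) \<Rightarrow> bool" where
  "hatLY_monotone u f \<longleftrightarrow>
     (\<forall>\<theta> \<theta>'. (\<forall>i. hatL_Y u f i (f \<theta>) \<theta> \<subseteq> lower_Y u i (return_pmf (f \<theta>)) \<theta>') \<longrightarrow> f \<theta> = f \<theta>')"

definition outcome :: "(('i::finite \<Rightarrow> nat) \<Rightarrow> 'z pmf) \<Rightarrow> ('i \<Rightarrow> nat pmf) \<Rightarrow> 'z pmf" where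
  "outcome g \<sigma> = bind_pmf (Pi_pmf UNIV 0 \<sigma>) g"

definition mixed_profile :: "('i \<Rightarrow> nat set) \<Rightarrow> ('i \<Rightarrow> nat pmf) \<Rightarrow> bool" where
  "mixed_profile M \<sigma> \<longleftrightarrow> (\<forall>i. set_pmf (\<sigma> i) \<subseteq> M i)"

definition pure_profile :: "('i \<Rightarrow> nat set) \<Rightarrow> ('i \<Rightarrow> nat) \<Rightarrow> bool" where
  "pure_profile M m \<longleftrightarrow> (\<forall>i. m i \<in> M i)"

definition MNE :: "('i::finite \<Rightarrow> 'th \<Rightarrow> 'z::finite \<Rightarrow> real) \<Rightarrow> ('i \<Rightarrow> nat set) \<Rightarrow> (('i \<Rightarrow> nat) \<Rightarrow> 'z pmf)
                    \<Rightarrow> 'th \<Rightarrow> ('i \<Rightarrow> nat pmf) set" where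
  "MNE u M g \<theta> = {\<sigma>. mixed_profile M \<sigma> \<and>
     (\<forall>i \<tau>. set_pmf \<tau> \<subseteq> M i \<longrightarrow> EU u i \<theta> (outcome g (\<sigma>(i := \<tau>))) \<le> EU u i \<theta> (outcome g \<sigma>))}"

definition PNE :: "('i \<Rightarrow> 'th \<Rightarrow> 'z::finite \<Rightarrow> real) \<Rightarrow> ('i \<Rightarrow> nat set) \<Rightarrow> (('i \<Rightarrow> nat) \<Rightarrow> 'z pmf)
                    \<Rightarrow> 'th \<Rightarrow> ('i \<Rightarrow> nat) set" where
  "PNE u M g \<theta> = {m. pure_profile M m \<and>
     (\<forall>i x. x \<in> M i \<longrightarrow> EU u i \<theta> (g (m(i := x))) \<le> EU u i \<theta> (g m))}"

definition mixed_Nash_implementable :: "('i::finite \<Rightarrow> 'th \<Rightarrow> 'z::finite \<Rightarrow> real) \<Rightarrow> ('th \<Rightarrow> 'z) \<Rightarrow> bool" where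
  "mixed_Nash_implementable u f \<longleftrightarrow>
     (\<exists>M g. \<forall>\<theta>. (\<Union>\<sigma>\<in>MNE u M g \<theta>. set_pmf (outcome g \<sigma>)) = {f \<theta>})"

definition pure_Nash_implementable :: "('i::finite \<Rightarrow> 'th \<Rightarrow> 'z::finite \<Rightarrow> real) \<Rightarrow> ('th \<Rightarrow> 'z) \<Rightarrow> bool" where
  "pure_Nash_implementable u f \<longleftrightarrow>
     (\<exists>M g. \<forall>\<theta>. (\<Union>m\<in>PNE u M g \<theta>. set_pmf (g m)) = {f \<theta>})"

definition double_Nash_implementable :: "('i::finite \<Rightarrow> 'th \<Rightarrow> 'z::finite \<Rightarrow> real) \<Rightarrow> ('th \<Rightarrow> 'z) \<Rightarrow> bool" where
  "double_Nash_implementable u f \<longleftrightarrow>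
     (\<exists>M g. \<forall>\<theta>. (\<Union>\<sigma>\<in>MNE u M g \<theta>. set_pmf (outcome g \<sigma>)) = {f \<theta>}
              \<and> (\<Union>m\<in>PNE u M g \<theta>. set_pmf (g m)) = {f \<theta>})"

end

theory Submission
  imports Defs
begin

text \<open>Necessity: an equilibrium at \<open>\<theta>\<close> remains one at \<open>\<theta>'\<close> as soon as the reduced lower contour sets
  nest, because every deviation lottery of agent \<open>i\<close> lies in the reduced set.

  Sufficiency: if all agents but \<open>i\<close> agree on \<open>\<theta>\<close>, agent \<open>i\<close> may choose from his reduced lower contour
  set at \<open>\<theta>\<close>; if there is no such agreement, the highest bidder may choose any lottery. The chosen
  lottery is diluted with a fixed one that is spread over all relevant outcomes, and the dilution
  vanishes as the bid grows. Hence in a mixed equilibrium every profile in the support already gives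
  each agent the supremum over his choices. Off consensus, optimality despite the dilution forces
  the chooser to be indifferent over the spread-out support and everyone else to rank all of it top.
  This contradicts monotonicity unless the only available choice is the desired outcome.\<close>

section \<open>Expected utility\<close>

lemma EU_expectation: "EU u i \<theta> y = measure_pmf.expectation y (u i \<theta>)"
  unfolding EU_def by (subst integral_measure_pmf_real[of UNIV]) (auto simp: mult.commute)

lemma EU_return [simp]: "EU u i \<theta> (return_pmf z) = u i \<theta> z"
  by (simp add: EU_expectation)

lemma EU_bounded: "\<bar>EU u i \<theta> y\<bar> \<le> (\<Sum>z\<in>UNIV. \<bar>u i \<theta> z\<bar>)"
proof -
  have "\<bar>EU u i \<theta> y\<bar> \<le> (\<Sum>z\<in>UNIV. \<bar>pmf y z * u i \<theta> z\<bar>)"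
    unfolding EU_def by (rule sum_abs)
  also have "\<dots> \<le> (\<Sum>z\<in>UNIV. \<bar>u i \<theta> z\<bar>)"
    by (intro sum_mono) (simp add: abs_mult mult_left_le_one_le pmf_le_1)
  finally show ?thesis .
qed

lemma integrable_bounded_pmf:
  fixes h :: "'a \<Rightarrow> real"
  assumes "\<And>x. \<bar>h x\<bar> \<le> B"
  shows "integrable (measure_pmf p) h"
  using assms by (intro measure_pmf.integrable_const_bound[where B = B]) auto

lemma integrable_EU: "integrable (measure_pmf p) (\<lambda>x. EU u i \<theta> (h x))"
  by (rule integrable_bounded_pmf[OF EU_bounded])

lemma EU_bind: "EU u i \<theta> (bind_pmf p h) = measure_pmf.expectation p (\<lambda>x. EU u i \<theta> (h x))"
proof -
  have int: "integrable (measure_pmf p) (\<lambda>x. pmf (h x) z)" for z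
    by (rule integrable_bounded_pmf[where B = 1]) (simp add: pmf_le_1)
  show ?thesis
    unfolding EU_def by (simp add: pmf_bind int)
qed

text \<open>A nonnegative difference with zero expectation vanishes almost surely, which for a
  \<open>pmf\<close> means on the whole support. This turns optimality on average into optimality at
  each profile.\<close>

lemma expectation_eq_imp_eq:
  fixes a b :: "'a \<Rightarrow> real"
  assumes "integrable (measure_pmf p) a" "integrable (measure_pmf p) b"
    and "\<And>x. x \<in> set_pmf p \<Longrightarrow> a x \<le> b x"
    and "measure_pmf.expectation p b \<le> measure_pmf.expectation p a"
    and "x \<in> set_pmf p"
  shows "a x = b x"
proof -
  have "measure_pmf.expectation p (\<lambda>x. b x - a x) = measure_pmf.expectation p b - measure_pmf.expectation p a"
    using assms by simp
  moreover have "measure_pmf.expectation p (\<lambda>x. b x - a x) \<ge> 0"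
    using assms(3) by (intro integral_nonneg_AE) (auto simp: AE_measure_pmf_iff)
  ultimately have "measure_pmf.expectation p (\<lambda>x. b x - a x) = 0"
    using assms(4) by linarith
  then have "AE x in measure_pmf p. b x - a x = 0"
    using assms by (subst (asm) integral_nonneg_eq_0_iff_AE) (auto simp: AE_measure_pmf_iff)
  then show ?thesis
    using assms(5) by (auto simp: AE_measure_pmf_iff)
qed

lemma EU_upper_bound_attained:
  assumes "\<And>z. z \<in> set_pmf y \<Longrightarrow> u i \<theta> z \<le> c" "c \<le> EU u i \<theta> y" "z \<in> set_pmf y"
  shows "u i \<theta> z = c"
  using assms
  by (intro expectation_eq_imp_eq[of y "u i \<theta>" "\<lambda>_. c"])
    (auto simp: EU_expectation integrable_measure_pmf_finite)

lemma EU_lower_bound_attained: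
  assumes "\<And>z. z \<in> set_pmf y \<Longrightarrow> c \<le> u i \<theta> z" "EU u i \<theta> y \<le> c" "z \<in> set_pmf y"
  shows "u i \<theta> z = c"
  using assms
  by (intro expectation_eq_imp_eq[of y "\<lambda>_. c" "u i \<theta>", symmetric])
    (auto simp: EU_expectation integrable_measure_pmf_finite)

lemma EU_const_on_support:
  assumes "\<And>z. z \<in> set_pmf y \<Longrightarrow> u i \<theta> z = c"
  shows "EU u i \<theta> y = c"
proof -
  have "EU u i \<theta> y = measure_pmf.expectation y (\<lambda>_. c)"
    unfolding EU_expectation
    by (intro integral_cong_AE) (auto simp: AE_measure_pmf_iff assms)
  then show ?thesis by simp
qed

lemma EU_le_bound:
  assumes "\<And>z. u i \<theta> z \<le> c"
  shows "EU u i \<theta> y \<le> c"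
proof -
  have "EU u i \<theta> y \<le> measure_pmf.expectation y (\<lambda>_. c)"
    unfolding EU_expectation
    by (intro integral_mono) (auto simp: assms integrable_measure_pmf_finite)
  then show ?thesis by simp
qed

lemma return_in_hatL_Y: "return_pmf (f \<theta>) \<in> hatL_Y u f i (f \<theta>) \<theta>"
  by (auto simp: hatL_Y_def lower_Y_def)

lemma hatL_Y_subset_lower_Y: "hatL_Y u f i (f \<theta>) \<theta> \<subseteq> lower_Y u i (return_pmf (f \<theta>)) \<theta>"
  by (auto simp: hatL_Y_def lower_Y_def)

section \<open>Necessity of monotonicity\<close>

text \<open>Strategy sets \<open>S\<close> and outcome map \<open>G\<close> are kept abstract so
  that one necessity proof serves both pure and mixed equilibria.\<close>

definition nash ::
  "('i \<Rightarrow> 'th \<Rightarrow> 'z::finite \<Rightarrow> real) \<Rightarrow> ('i \<Rightarrow> 's set) \<Rightarrow> (('i \<Rightarrow> 's) \<Rightarrow> 'z pmf) \<Rightarrow> 'th \<Rightarrow> ('i \<Rightarrow> 's) set" where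
  "nash u S G \<theta> = {\<sigma>. (\<forall>i. \<sigma> i \<in> S i) \<and>
     (\<forall>i. \<forall>\<tau>\<in>S i. EU u i \<theta> (G (\<sigma>(i := \<tau>))) \<le> EU u i \<theta> (G \<sigma>))}"

lemma PNE_eq_nash: "PNE u M g \<theta> = nash u M g \<theta>"
  by (auto simp: PNE_def nash_def pure_profile_def)

lemma MNE_eq_nash: "MNE u M g \<theta> = nash u (\<lambda>i. {\<tau>. set_pmf \<tau> \<subseteq> M i}) (outcome g) \<theta>"
  by (auto simp: MNE_def nash_def mixed_profile_def)

text \<open>If the reduced lower contour set of \<open>i\<close> is the singleton, every deviation of \<open>i\<close> is supported
  on an \<open>i\<close>-max set, hence yields an equilibrium at the state witnessing maximality; implementation
  at that state then forces the deviation to produce \<open>f \<theta>\<close> itself.\<close>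

lemma nash_deviation_in_hatL_Y:
  fixes u :: "'i \<Rightarrow> 'th \<Rightarrow> 'z::finite \<Rightarrow> real"
  assumes impl: "\<And>\<theta>. (\<Union>\<sigma>\<in>nash u S G \<theta>. set_pmf (G \<sigma>)) = {f \<theta>}"
    and \<sigma>: "\<sigma> \<in> nash u S G \<theta>" and \<tau>: "\<tau> \<in> S i"
  shows "G (\<sigma>(i := \<tau>)) \<in> hatL_Y u f i (f \<theta>) \<theta>"
proof -
  have G_nash: "G s = return_pmf (f \<theta>)" if "s \<in> nash u S G \<theta>" for s \<theta>
    using impl[of \<theta>] that by (subst set_pmf_subset_singleton[symmetric]) blast
  have dev: "EU u i \<theta> (G (\<sigma>(i := t))) \<le> u i \<theta> (f \<theta>)" if "t \<in> S i" for t
    using \<sigma> that G_nash[OF \<sigma>] by (auto simp: nash_def)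
  show ?thesis
  proof (cases "f \<theta> \<in> argmin_on (u i \<theta>) UNIV \<and> is_i_max u i (lower_Z u i (return_pmf (f \<theta>)) \<theta>)")
    case False
    then have "hatL_Y u f i (f \<theta>) \<theta> = lower_Y u i (return_pmf (f \<theta>)) \<theta>"
      unfolding hatL_Y_def by auto
    then show ?thesis
      using dev[OF \<tau>] by (simp add: lower_Y_def)
  next
    case True
    define E where "E = lower_Z u i (return_pmf (f \<theta>)) \<theta>"
    obtain \<eta> where \<eta>: "is_i_theta_max u i \<eta> E"
      using True by (auto simp: is_i_max_def E_def)
    have min: "u i \<theta> (f \<theta>) \<le> u i \<theta> z" for z
      using True by (simp add: argmin_on_def)
    \<comment> \<open>A deviation is worth at most \<open>u i \<theta> (f \<theta>)\<close>, the
      minimum of \<open>u i \<theta>\<close>, so every outcome in its support attains that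
      minimum.\<close>
    have supp: "set_pmf (G (\<sigma>(i := t))) \<subseteq> E" if "t \<in> S i" for t
    proof
      fix z assume "z \<in> set_pmf (G (\<sigma>(i := t)))"
      then have "u i \<theta> z = u i \<theta> (f \<theta>)"
        by (rule EU_lower_bound_attained[where y = "G (\<sigma>(i := t))" and u = u and \<theta> = \<theta>, OF min dev[OF that]])
      then show "z \<in> E"
        by (simp add: E_def lower_Z_def)
    qed
    have Ei: "u i \<eta> z = u i \<eta> z'" if "z \<in> E" "z' \<in> E" for z z'
    proof (rule antisym)
      show "u i \<eta> z \<le> u i \<eta> z'" "u i \<eta> z' \<le> u i \<eta> z"
        using \<eta> that unfolding is_i_theta_max_def argmax_on_def by blast+
    qed
    have Ej: "u j \<eta> z' \<le> u j \<eta> z" if "z \<in> E" "j \<noteq> i" for j z z'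
      using \<eta> that unfolding is_i_theta_max_def argmax_on_def by blast
    obtain e where e: "e \<in> E"
      using \<eta> by (auto simp: is_i_theta_max_def)
    have EUi: "EU u i \<eta> (G (\<sigma>(i := t))) = u i \<eta> e" if "t \<in> S i" for t
      using supp[OF that] Ei e by (intro EU_const_on_support) blast
    have EUj: "EU u j \<eta> y \<le> EU u j \<eta> (G (\<sigma>(i := t)))" if "t \<in> S i" "j \<noteq> i" for t j y
    proof -
      have "EU u j \<eta> y \<le> u j \<eta> e"
        using Ej[OF e that(2)] by (rule EU_le_bound)
      also have "\<dots> = EU u j \<eta> (G (\<sigma>(i := t)))"
      proof (rule EU_const_on_support[symmetric])
        fix z assume "z \<in> set_pmf (G (\<sigma>(i := t)))"
        then have "z \<in> E" using supp[OF that(1)] by blast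
        then show "u j \<eta> z = u j \<eta> e"
          using Ej[OF _ that(2)] e by (intro antisym) auto
      qed
      finally show ?thesis .
    qed
    \<comment> \<open>At \<open>\<eta>\<close> the others already get a global maximum, and
      \<open>i\<close> is indifferent on \<open>E\<close>, which supports all his
      deviations.\<close>
    have ne: "\<sigma>(i := t) \<in> nash u S G \<eta>" if "t \<in> S i" for t
    proof -
      have "EU u j \<eta> (G ((\<sigma>(i := t))(j := s))) \<le> EU u j \<eta> (G (\<sigma>(i := t)))" if "s \<in> S j" for j s
        using EUj[OF \<open>t \<in> S i\<close>] EUi[OF \<open>t \<in> S i\<close>] EUi[of s] that by (cases "j = i") auto
      then show ?thesis
        using \<sigma> that by (auto simp: nash_def)
    qed
    have "\<sigma> i \<in> S i"
      using \<sigma> by (auto simp: nash_def)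
    \<comment> \<open>The choice \<open>t = \<sigma> i\<close> shows that \<open>\<sigma>\<close>
      itself is an equilibrium at both states.\<close>
    then have "f \<eta> = f \<theta>"
      using G_nash[OF ne[of "\<sigma> i"]] G_nash[OF \<sigma>] by simp
    then have "G (\<sigma>(i := \<tau>)) = return_pmf (f \<theta>)"
      using G_nash[OF ne[OF \<tau>]] by simp
    then show ?thesis
      by (simp add: return_in_hatL_Y)
  qed
qed

lemma nash_implementation_imp_monotone:
  fixes u :: "'i \<Rightarrow> 'th \<Rightarrow> 'z::finite \<Rightarrow> real"
  assumes impl: "\<And>\<theta>. (\<Union>\<sigma>\<in>nash u S G \<theta>. set_pmf (G \<sigma>)) = {f \<theta>}"
  shows "hatLY_monotone u f"
  unfolding hatLY_monotone_def
proof (intro allI impI)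
  fix \<theta> \<theta>'
  assume sub: "\<forall>i. hatL_Y u f i (f \<theta>) \<theta> \<subseteq> lower_Y u i (return_pmf (f \<theta>)) \<theta>'"
  obtain \<sigma> where \<sigma>: "\<sigma> \<in> nash u S G \<theta>"
    using impl[of \<theta>] by blast
  then have G: "G \<sigma> = return_pmf (f \<theta>)"
    using impl[of \<theta>] by (subst set_pmf_subset_singleton[symmetric]) blast
  have "EU u i \<theta>' (G (\<sigma>(i := \<tau>))) \<le> EU u i \<theta>' (G \<sigma>)" if "\<tau> \<in> S i" for i \<tau>
    using nash_deviation_in_hatL_Y[OF impl \<sigma> that] sub G by (auto simp: lower_Y_def)
  then have "\<sigma> \<in> nash u S G \<theta>'"
    using \<sigma> by (auto simp: nash_def)
  then have "set_pmf (G \<sigma>) \<subseteq> {f \<theta>'}"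
    using impl[of \<theta>'] by blast
  then show "f \<theta> = f \<theta>'"
    using G by simp
qed

section \<open>Mixing lotteries\<close>

definition mix :: "real \<Rightarrow> 'a pmf \<Rightarrow> 'a pmf \<Rightarrow> 'a pmf" where
  "mix p x y = bind_pmf (bernoulli_pmf p) (\<lambda>b. if b then x else y)"

lemma EU_mix:
  assumes "0 \<le> p" "p \<le> 1"
  shows "EU u i \<theta> (mix p x y) = p * EU u i \<theta> x + (1 - p) * EU u i \<theta> y"
  using assms by (simp add: mix_def EU_bind)

lemma set_pmf_mix:
  assumes "0 < p" "p \<le> 1"
  shows "set_pmf x \<subseteq> set_pmf (mix p x y)"
proof -
  have "True \<in> set_pmf (bernoulli_pmf p)"
    using assms by (simp add: set_pmf_iff)
  then show ?thesis
    unfolding mix_def set_bind_pmf by force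
qed

lemma mix_singleton: "mix p y y = y"
  by (simp add: mix_def)

text \<open>Convexity: the reduced set is either a single lottery or the trace of a half-space on
  the simplex.\<close>

lemma mix_in_hatL_Y:
  assumes "x \<in> hatL_Y u f i a \<theta>" "y \<in> hatL_Y u f i a \<theta>" "0 \<le> p" "p \<le> 1"
  shows "mix p x y \<in> hatL_Y u f i a \<theta>"
proof -
  have "p * s + (1 - p) * t \<le> c" if "s \<le> c" "t \<le> c" for s t c :: real
    using convex_bound_le[OF that, of p "1 - p"] assms(3,4) by simp
  then show ?thesis
    using assms by (auto simp: hatL_Y_def lower_Y_def mix_singleton EU_mix split: if_splits)
qed


section \<open>The implementing mechanism\<close>

text \<open>A message is a pair of a state and an integer. The pair \<open>(\<theta>, 0)\<close> serves as a vote for \<open>f \<theta>\<close>;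
  an agent who is called upon to choose has the state read as a report of his own preferences and
  the integer as a bid.\<close>

definition agree :: "'i \<Rightarrow> 'th \<Rightarrow> ('i \<Rightarrow> 'th \<times> nat) \<Rightarrow> bool" where
  "agree i \<theta> c \<longleftrightarrow> (\<forall>l. l \<noteq> i \<longrightarrow> c l = (\<theta>, 0))"

text \<open>Without agreement among the others the condition is vacuous and every lottery is
  allowed.\<close>

definition choices :: "('i \<Rightarrow> 'th \<Rightarrow> 'z::finite \<Rightarrow> real) \<Rightarrow> ('th \<Rightarrow> 'z) \<Rightarrow> 'i \<Rightarrow> ('i \<Rightarrow> 'th \<times> nat) \<Rightarrow> 'z pmf set" where
  "choices u f i c = {y. \<forall>\<theta>. agree i \<theta> c \<longrightarrow> y \<in> hatL_Y u f i (f \<theta>) \<theta>}"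

text \<open>A centre of a choice set is the lottery used for dilution: it can be optimal for the chooser, with
  all other agents fully satisfied, only if the set offers nothing but the desired outcome.\<close>

definition is_centre :: "('i \<Rightarrow> 'th \<Rightarrow> 'z::finite \<Rightarrow> real) \<Rightarrow> ('th \<Rightarrow> 'z) \<Rightarrow> 'i \<Rightarrow> 'z pmf set \<Rightarrow> 'z pmf \<Rightarrow> bool" where
  "is_centre u f i A r \<longleftrightarrow> r \<in> A \<and>
     (\<forall>\<theta>. (\<forall>y\<in>A. EU u i \<theta> y \<le> EU u i \<theta> r) \<and> (\<forall>j. j \<noteq> i \<longrightarrow> set_pmf r \<subseteq> argmax_on (u j \<theta>) UNIV)
        \<longrightarrow> A = {return_pmf (f \<theta>)})"

definition centre :: "('i \<Rightarrow> 'th \<Rightarrow> 'z::finite \<Rightarrow> real) \<Rightarrow> ('th \<Rightarrow> 'z) \<Rightarrow> 'i \<Rightarrow> 'z pmf set \<Rightarrow> 'z pmf" where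
  "centre u f i A = (SOME r. is_centre u f i A r)"

definition best_value :: "('i \<Rightarrow> 'th \<Rightarrow> 'z::finite \<Rightarrow> real) \<Rightarrow> 'i \<Rightarrow> 'th \<Rightarrow> 'z pmf set \<Rightarrow> real" where
  "best_value u i \<theta> A = Sup (EU u i \<theta> ` A)"

text \<open>The positive slack \<open>1 / Suc (snd m)\<close> lets the supremum alone guarantee
  existence, and it vanishes as the bid grows.\<close>

definition near_best :: "('i \<Rightarrow> 'th \<Rightarrow> 'z::finite \<Rightarrow> real) \<Rightarrow> 'i \<Rightarrow> 'z pmf set \<Rightarrow> 'th \<times> nat \<Rightarrow> 'z pmf" where
  "near_best u i A m = (SOME y. y \<in> A \<and> best_value u i (fst m) A - 1 / Suc (snd m) \<le> EU u i (fst m) y)"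

definition pick :: "('i \<Rightarrow> 'th \<Rightarrow> 'z::finite \<Rightarrow> real) \<Rightarrow> ('th \<Rightarrow> 'z) \<Rightarrow> 'i \<Rightarrow> ('i \<Rightarrow> 'th \<times> nat) \<Rightarrow> 'z pmf" where
  "pick u f i c = mix (1 / Suc (snd (c i))) (centre u f i (choices u f i c)) (near_best u i (choices u f i c) (c i))"

text \<open>Under full consensus every agent qualifies, but \<open>canon\<close> settles that case
  before consulting \<open>winner\<close>. Ties between bids are broken by
  \<open>SOME\<close>.\<close>

definition winner :: "('i \<Rightarrow> 'th \<times> nat) \<Rightarrow> 'i" where
  "winner c = (SOME i. (\<exists>\<theta>. agree i \<theta> c) \<or> ((\<forall>j \<theta>. \<not> agree j \<theta> c) \<and> (\<forall>l. snd (c l) \<le> snd (c i))))"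

text \<open>In the first branch \<open>c\<close> is constant, so \<open>undefined\<close> merely
  names some agent from whom the common vote is read.\<close>

definition canon :: "('i \<Rightarrow> 'th \<Rightarrow> 'z::finite \<Rightarrow> real) \<Rightarrow> ('th \<Rightarrow> 'z) \<Rightarrow> ('i \<Rightarrow> 'th \<times> nat) \<Rightarrow> 'z pmf" where
  "canon u f c = (if \<exists>\<theta>. c = (\<lambda>_. (\<theta>, 0)) then return_pmf (f (fst (c undefined))) else pick u f (winner c) c)"

section \<open>Suprema over choice sets\<close>

lemma bdd_above_EU: "bdd_above (EU u i \<theta> ` A)"
  using abs_le_D1[OF EU_bounded] by (auto intro!: bdd_aboveI)

lemma EU_le_best_value: "y \<in> A \<Longrightarrow> EU u i \<theta> y \<le> best_value u i \<theta> A"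
  unfolding best_value_def by (intro cSup_upper bdd_above_EU) auto

lemma best_value_bounded:
  assumes "A \<noteq> {}"
  shows "\<bar>best_value u i \<theta> A\<bar> \<le> (\<Sum>z\<in>UNIV. \<bar>u i \<theta> z\<bar>)"
  unfolding best_value_def using assms by (intro cSup_abs_le) (auto simp: EU_bounded)

lemma near_best:
  assumes "A \<noteq> {}"
  shows "near_best u i A m \<in> A"
    and "best_value u i (fst m) A - 1 / Suc (snd m) \<le> EU u i (fst m) (near_best u i A m)"
proof -
  have "\<exists>v\<in>EU u i (fst m) ` A. best_value u i (fst m) A - 1 / Suc (snd m) < v"
    unfolding best_value_def using assms by (intro less_cSupD) auto
  then have "\<exists>y. y \<in> A \<and> best_value u i (fst m) A - 1 / Suc (snd m) \<le> EU u i (fst m) y"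
    by (auto intro: less_imp_le)
  from someI_ex[OF this, folded near_best_def]
  show "near_best u i A m \<in> A"
    and "best_value u i (fst m) A - 1 / Suc (snd m) \<le> EU u i (fst m) (near_best u i A m)"
    by blast+
qed

lemma mix_in_choices:
  assumes "x \<in> choices u f i c" "y \<in> choices u f i c" "0 \<le> p" "p \<le> 1"
  shows "mix p x y \<in> choices u f i c"
  unfolding choices_def
proof (intro CollectI allI impI)
  fix \<theta> assume "agree i \<theta> c"
  then show "mix p x y \<in> hatL_Y u f i (f \<theta>) \<theta>"
    using assms by (intro mix_in_hatL_Y) (simp_all add: choices_def)
qed

text \<open>If no member of a finite set exceeds the average, all members equal it.\<close>

lemma uniform_not_below_imp_const:
  fixes u :: "'i \<Rightarrow> 'th \<Rightarrow> 'z::finite \<Rightarrow> real"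
  assumes "E \<noteq> {}" "\<And>z. z \<in> E \<Longrightarrow> u i \<theta> z \<le> EU u i \<theta> (pmf_of_set E)"
  shows "E \<subseteq> argmax_on (u i \<theta>) E"
proof -
  have "u i \<theta> z = EU u i \<theta> (pmf_of_set E)" if "z \<in> E" for z
    using assms that by (intro EU_upper_bound_attained[of "pmf_of_set E"]) auto
  then show ?thesis by (auto simp: argmax_on_def)
qed

section \<open>Unanimity among the others, and existence of centres\<close>

locale monotone_scf =
  fixes u :: "'i::finite \<Rightarrow> 'th::countable \<Rightarrow> 'z::finite \<Rightarrow> real"
    and f :: "'th \<Rightarrow> 'z"
  assumes three_agents: "CARD('i) \<ge> 3"
    and two_values: "card (range f) \<ge> 2"
    and monotone: "hatLY_monotone u f"
begin

text \<open>Three agents enter here: two groups that each omit one agent share a member, so their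
  unanimous votes coincide.\<close>

lemma other_agent: obtains l :: 'i where "l \<noteq> i" "l \<noteq> j"
proof -
  have "card {i, j} \<le> 2"
    by (simp add: card_insert_if)
  then have "card {i, j} < CARD('i)"
    using three_agents by linarith
  then have "{i, j} \<noteq> UNIV" by auto
  then show ?thesis using that by auto
qed

lemma agree_unique:
  fixes c :: "'i \<Rightarrow> 'th \<times> nat"
  assumes "agree i \<theta> c" "agree j \<theta>' c"
  shows "\<theta> = \<theta>'"
proof -
  obtain l where "l \<noteq> i" "l \<noteq> j" by (rule other_agent)
  then have "c l = (\<theta>, 0)" "c l = (\<theta>', 0)"
    using assms by (auto simp: agree_def)
  then show ?thesis by simp
qed

lemma agree_two_imp_consensus:
  fixes c :: "'i \<Rightarrow> 'th \<times> nat"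
  assumes "agree i \<theta> c" "agree j \<theta>' c" "i \<noteq> j"
  shows "c = (\<lambda>_. (\<theta>, 0))"
proof
  fix l show "c l = (\<theta>, 0)"
    using agree_unique[OF assms(1,2)] assms by (cases "l = i") (auto simp: agree_def)
qed

lemma choices_agree:
  assumes "agree i \<theta> c"
  shows "choices u f i c = hatL_Y u f i (f \<theta>) \<theta>"
proof -
  have "agree i \<eta> c \<longleftrightarrow> \<eta> = \<theta>" for \<eta>
    using assms agree_unique by metis
  then show ?thesis
    by (simp add: choices_def)
qed

text \<open>Total indifference at \<open>\<theta>\<close> makes every lower contour set there all of
  Y, so monotonicity from each \<open>\<eta>\<close> to \<open>\<theta>\<close> would make
  \<open>f\<close> constant.\<close>

lemma not_all_indifferent: "\<exists>j. \<not> UNIV \<subseteq> argmax_on (u j \<theta>) UNIV"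
proof (rule ccontr)
  assume "\<not> ?thesis"
  then have "lower_Y u j (return_pmf a) \<theta> = UNIV" for j a
    by (auto simp: lower_Y_def argmax_on_def subset_iff intro!: EU_le_bound)
  then have "f \<eta> = f \<theta>" for \<eta>
    using monotone unfolding hatLY_monotone_def by blast
  then have "range f = {f \<theta>}" by auto
  then show False using two_values by simp
qed

text \<open>The centre is the only lottery of a singleton set; else uniform on \<open>E\<close> if
  \<open>f \<theta>\<close> is worst for \<open>i\<close>; else a full-support lottery pulled down
  towards a worse outcome.\<close>

lemma hatL_Y_has_centre: "\<exists>r. is_centre u f i (hatL_Y u f i (f \<theta>) \<theta>) r"
proof -
  define a where "a = f \<theta>"
  define E where "E = lower_Z u i (return_pmf a) \<theta>"
  consider (trivial) "a \<in> argmin_on (u i \<theta>) UNIV" "is_i_max u i E"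
    | (flat) "a \<in> argmin_on (u i \<theta>) UNIV" "\<not> is_i_max u i E"
    | (worse) w where "u i \<theta> w < u i \<theta> a"
    unfolding argmin_on_def mem_Collect_eq by (meson UNIV_I not_le)
  then show ?thesis
  proof cases
    case trivial
    then have A: "hatL_Y u f i (f \<theta>) \<theta> = {return_pmf a}"
      by (simp add: hatL_Y_def a_def E_def)
    \<comment> \<open>The others rank \<open>a\<close> top at \<open>\<eta>\<close> and the reduced
      set of \<open>i\<close> is a singleton, so the premise of monotonicity holds for
      everyone.\<close>
    have "a = f \<eta>" if "\<forall>j. j \<noteq> i \<longrightarrow> {a} \<subseteq> argmax_on (u j \<eta>) UNIV" for \<eta>
    proof -
      have "hatL_Y u f j (f \<theta>) \<theta> \<subseteq> lower_Y u j (return_pmf (f \<theta>)) \<eta>" for j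
      proof (cases "j = i")
        case True
        then show ?thesis using A by (simp add: a_def lower_Y_def)
      next
        case False
        then show ?thesis
          using that by (auto simp: lower_Y_def argmax_on_def a_def intro!: EU_le_bound)
      qed
      then show ?thesis
        using monotone unfolding hatLY_monotone_def a_def by blast
    qed
    then have "is_centre u f i {return_pmf a} (return_pmf a)"
      by (auto simp: is_centre_def)
    then show ?thesis using A by auto
  next
    case flat
    then have A: "hatL_Y u f i (f \<theta>) \<theta> = lower_Y u i (return_pmf a) \<theta>"
      by (simp add: hatL_Y_def a_def E_def)
    have "a \<in> E" by (simp add: E_def lower_Z_def)
    then have ne: "E \<noteq> {}" by auto
    have "pmf_of_set E \<in> lower_Y u i (return_pmf a) \<theta>"
    proof -
      have "EU u i \<theta> (pmf_of_set E) = u i \<theta> a"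
      proof (rule EU_const_on_support)
        fix z assume "z \<in> set_pmf (pmf_of_set E)"
        then show "u i \<theta> z = u i \<theta> a"
          using ne flat(1) by (intro antisym) (auto simp: E_def lower_Z_def argmin_on_def)
      qed
      then show ?thesis by (simp add: lower_Y_def)
    qed
    \<comment> \<open>Degenerate lotteries on \<open>E\<close> are available, so optimality of the
      uniform one makes \<open>i\<close> indifferent on \<open>E\<close>; then \<open>E\<close>
      would be an \<open>i\<close>-max set.\<close>
    moreover have False
      if opt: "\<forall>y\<in>lower_Y u i (return_pmf a) \<theta>. EU u i \<eta> y \<le> EU u i \<eta> (pmf_of_set E)"
        and top: "\<forall>j. j \<noteq> i \<longrightarrow> E \<subseteq> argmax_on (u j \<eta>) UNIV" for \<eta>
    proof -
      have "u i \<eta> z \<le> EU u i \<eta> (pmf_of_set E)" if "z \<in> E" for z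
      proof -
        have "return_pmf z \<in> lower_Y u i (return_pmf a) \<theta>"
          using that by (simp add: lower_Y_def E_def lower_Z_def)
        then show ?thesis
          using opt[rule_format, of "return_pmf z"] by simp
      qed
      then have "is_i_theta_max u i \<eta> E"
        using uniform_not_below_imp_const[OF ne, of u i \<eta>] top ne by (simp add: is_i_theta_max_def)
      then show False
        using flat(2) by (auto simp: is_i_max_def)
    qed
    ultimately have "is_centre u f i (lower_Y u i (return_pmf a) \<theta>) (pmf_of_set E)"
      using ne by (auto simp: is_centre_def)
    then show ?thesis using A by auto
  next
    case worse
    then have A: "hatL_Y u f i (f \<theta>) \<theta> = lower_Y u i (return_pmf a) \<theta>"
      by (auto simp: hatL_Y_def a_def argmin_on_def simp flip: not_le)
    \<comment> \<open>\<open>D\<close> bounds the gain of any lottery over \<open>w\<close>. The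
      weight \<open>\<epsilon>\<close> solves
      \<open>\<epsilon> * D = u i \<theta> a - u i \<theta> w\<close>, so any lottery with this
      weight, mixed with \<open>w\<close>, stays weakly below \<open>a\<close>.\<close>
    define D where "D = Max (range (\<lambda>z. u i \<theta> z - u i \<theta> w))"
    define \<epsilon> where "\<epsilon> = (u i \<theta> a - u i \<theta> w) / D"
    have D: "u i \<theta> z - u i \<theta> w \<le> D" for z
      unfolding D_def by (intro Max_ge) auto
    have "0 < D" using D[of a] worse by linarith
    then have \<epsilon>: "0 < \<epsilon>" "\<epsilon> \<le> 1" using D[of a] worse by (auto simp: \<epsilon>_def)
    have in_L: "mix \<epsilon> y (return_pmf w) \<in> lower_Y u i (return_pmf a) \<theta>" for y
    proof -
      have "EU u i \<theta> y \<le> u i \<theta> w + D"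
        by (rule EU_le_bound) (use D in \<open>simp add: algebra_simps\<close>)
      then have "\<epsilon> * (EU u i \<theta> y - u i \<theta> w) \<le> \<epsilon> * D"
        using \<epsilon> by (intro mult_left_mono) auto
      also have "\<dots> = u i \<theta> a - u i \<theta> w"
        using \<open>0 < D\<close> by (simp add: \<epsilon>_def)
      finally show ?thesis
        using \<epsilon> by (simp add: lower_Y_def EU_mix algebra_simps)
    qed
    define r where "r = mix \<epsilon> (pmf_of_set UNIV) (return_pmf w)"
    have full: "set_pmf r = UNIV"
      using set_pmf_mix[OF \<epsilon>, of "pmf_of_set UNIV" "return_pmf w"] by (auto simp: r_def)
    have False
      if "\<forall>y\<in>lower_Y u i (return_pmf a) \<theta>. EU u i \<eta> y \<le> EU u i \<eta> r"
        and "\<forall>j. j \<noteq> i \<longrightarrow> UNIV \<subseteq> argmax_on (u j \<eta>) UNIV" for \<eta>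
    proof -
      \<comment> \<open>Comparing \<open>r\<close> with \<open>z\<close> mixed into \<open>w\<close>
        at the same weight cancels the contribution of \<open>w\<close>.\<close>
      have "u i \<eta> z \<le> EU u i \<eta> (pmf_of_set UNIV)" for z
        using that(1)[rule_format, OF in_L[of "return_pmf z"]] \<epsilon> by (simp add: r_def EU_mix)
      then have "UNIV \<subseteq> argmax_on (u i \<eta>) UNIV"
        by (intro uniform_not_below_imp_const) auto
      then show False
        using that(2) not_all_indifferent by metis
    qed
    then have "is_centre u f i (lower_Y u i (return_pmf a) \<theta>) r"
      using in_L full unfolding is_centre_def r_def by metis
    then show ?thesis using A by auto
  qed
qed

lemma UNIV_has_centre: "\<exists>r. is_centre u f i UNIV r"
proof -
  have False
    if "\<forall>y. EU u i \<eta> y \<le> EU u i \<eta> (pmf_of_set UNIV)"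
      and "\<forall>j. j \<noteq> i \<longrightarrow> UNIV \<subseteq> argmax_on (u j \<eta>) UNIV" for \<eta>
  proof -
    have "u i \<eta> z \<le> EU u i \<eta> (pmf_of_set UNIV)" for z
      using that(1)[rule_format, of "return_pmf z"] by simp
    then have "UNIV \<subseteq> argmax_on (u i \<eta>) UNIV"
      by (intro uniform_not_below_imp_const) auto
    then show False
      using that(2) not_all_indifferent by metis
  qed
  then have "is_centre u f i UNIV (pmf_of_set UNIV)"
    by (auto simp: is_centre_def)
  then show ?thesis by blast
qed

lemma is_centre_centre: "is_centre u f i (choices u f i c) (centre u f i (choices u f i c))"
proof -
  have "\<exists>r. is_centre u f i (choices u f i c) r"
  proof (cases "\<exists>\<theta>. agree i \<theta> c")
    case True
    then show ?thesis
      using choices_agree hatL_Y_has_centre by metis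
  next
    case False
    then have "choices u f i c = UNIV" by (auto simp: choices_def)
    then show ?thesis using UNIV_has_centre by simp
  qed
  then show ?thesis
    unfolding centre_def by (rule someI_ex)
qed

lemma centre_in_choices: "centre u f i (choices u f i c) \<in> choices u f i c"
  using is_centre_centre by (auto simp: is_centre_def)

lemma choices_nonempty: "choices u f i c \<noteq> {}"
  using centre_in_choices by blast

lemma pick_in_choices: "pick u f i c \<in> choices u f i c"
  unfolding pick_def
  by (rule mix_in_choices[OF centre_in_choices near_best(1)[OF choices_nonempty]]) simp_all

section \<open>The winner and the payoffs within reach\<close>

lemma winner:
  fixes c :: "'i \<Rightarrow> 'th \<times> nat"
  shows "(\<exists>\<theta>. agree (winner c) \<theta> c) \<or> ((\<forall>j \<theta>. \<not> agree j \<theta> c) \<and> (\<forall>l. snd (c l) \<le> snd (c (winner c))))"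
proof -
  have "finite (range (snd \<circ> c))" by simp
  then have "Max (range (snd \<circ> c)) \<in> range (snd \<circ> c)"
    by (rule Max_in) simp
  then obtain i where i: "Max (range (snd \<circ> c)) = snd (c i)"
    unfolding comp_def by (rule rangeE)
  have "snd (c l) \<le> snd (c i)" for l
    unfolding i[symmetric] by (intro Max_ge) auto
  then have "\<exists>i. (\<exists>\<theta>. agree i \<theta> c) \<or> ((\<forall>j \<theta>. \<not> agree j \<theta> c) \<and> (\<forall>l. snd (c l) \<le> snd (c i)))"
    by metis
  then show ?thesis
    unfolding winner_def by (rule someI_ex)
qed

lemma winner_agree:
  fixes c :: "'i \<Rightarrow> 'th \<times> nat"
  assumes "agree i \<theta> c" "\<nexists>\<theta>. c = (\<lambda>_. (\<theta>, 0))"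
  shows "winner c = i"
proof (rule ccontr)
  assume "winner c \<noteq> i"
  moreover obtain \<eta> where "agree (winner c) \<eta> c"
    using winner[of c] assms(1) by blast
  ultimately show False
    using agree_two_imp_consensus assms by blast
qed

lemma winner_high_bid:
  fixes c :: "'i \<Rightarrow> 'th \<times> nat"
  assumes "\<And>l. l \<noteq> i \<Longrightarrow> snd (c l) < snd (c i)"
  shows "winner c = i"
proof -
  \<comment> \<open>A strictly highest bid is positive, so the message of \<open>i\<close> is not a
    vote and no other agent can face unanimous opponents.\<close>
  obtain l where "l \<noteq> i" using other_agent by blast
  then have "0 < snd (c i)" using assms by fastforce
  then have "\<not> agree j \<theta> c" if "j \<noteq> i" for j \<theta>
    using that by (auto simp: agree_def)
  then show ?thesis
    using winner[of c] assms leD by metis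
qed

lemma canon_consensus: "canon u f (\<lambda>_. (\<theta>, 0)) = return_pmf (f \<theta>)"
  by (auto simp: canon_def)

text \<open>This covers every agent, not only the winner: off consensus, a non-winner faces no
  unanimous opponents, so his choice set is everything.\<close>

lemma canon_in_choices: "canon u f c \<in> choices u f i c"
proof (cases "\<exists>\<theta>. c = (\<lambda>_. (\<theta>, 0))")
  case True
  then obtain \<theta> where \<theta>: "c = (\<lambda>_. (\<theta>, 0))" ..
  then have "agree i \<theta> c" by (simp add: agree_def)
  then show ?thesis
    using \<theta> choices_agree by (simp add: canon_consensus return_in_hatL_Y)
next
  case False
  show ?thesis
  proof (cases "winner c = i")
    case True
    then show ?thesis using False pick_in_choices by (auto simp: canon_def)
  next
    case no: False
    then have "\<not> agree i \<theta> c" for \<theta>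
      using winner_agree False by blast
    then show ?thesis by (auto simp: choices_def)
  qed
qed

text \<open>Only the messages of the others matter, so a deviation leaves the agent's own bound
  unchanged.\<close>

lemma choices_upd: "choices u f i (c(i := m)) = choices u f i c"
  by (auto simp: choices_def agree_def)

text \<open>A bid above \<open>N\<close> wins, and both the weight of the centre and the slack of
  the near-best choice tend to 0. The values are squeezed between this estimate and the
  supremum.\<close>

lemma canon_high_bid_tendsto:
  "(\<lambda>k. EU u i \<theta> (canon u f (c(i := (\<theta>, k))))) \<longlonglongrightarrow> best_value u i \<theta> (choices u f i c)"
proof -
  define A where "A = choices u f i c"
  define V where "V = best_value u i \<theta> A"
  define R where "R = EU u i \<theta> (centre u f i A)"
  define N where "N = Max (range (snd \<circ> c))"
  have N: "snd (c l) \<le> N" for l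
    unfolding N_def by (intro Max_ge) auto
  have lower: "1 / Suc k * R + (1 - 1 / Suc k) * (V - 1 / Suc k) \<le> EU u i \<theta> (canon u f (c(i := (\<theta>, k))))"
    if "N < k" for k
  proof -
    let ?c = "c(i := (\<theta>, k))"
    have "winner ?c = i"
      using N that by (intro winner_high_bid) (auto intro: le_less_trans)
    moreover have "?c \<noteq> (\<lambda>_. (\<eta>, 0))" for \<eta>
      using that by (metis fun_upd_same less_nat_zero_code snd_conv)
    ultimately have "canon u f ?c = mix (1 / Suc k) (centre u f i A) (near_best u i A (\<theta>, k))"
      by (simp add: canon_def pick_def choices_upd A_def)
    moreover have "V - 1 / Suc k \<le> EU u i \<theta> (near_best u i A (\<theta>, k))"
      using near_best(2)[of A u i "(\<theta>, k)"] choices_nonempty by (simp add: A_def V_def)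
    then have "(1 - 1 / Suc k) * (V - 1 / Suc k) \<le> (1 - 1 / Suc k) * EU u i \<theta> (near_best u i A (\<theta>, k))"
      by (intro mult_left_mono) auto
    ultimately show ?thesis
      by (simp add: EU_mix R_def)
  qed
  have upper: "EU u i \<theta> (canon u f (c(i := (\<theta>, k)))) \<le> V" for k
    unfolding V_def A_def by (rule EU_le_best_value) (metis canon_in_choices choices_upd)
  have inv: "(\<lambda>k. 1 / real (Suc k)) \<longlonglongrightarrow> 0"
    using LIMSEQ_inverse_real_of_nat by (simp add: inverse_eq_divide)
  have "(\<lambda>k. 1 / Suc k * R + (1 - 1 / Suc k) * (V - 1 / Suc k)) \<longlonglongrightarrow> 0 * R + (1 - 0) * (V - 0)"
    by (intro tendsto_intros inv)
  then have lim: "(\<lambda>k. 1 / Suc k * R + (1 - 1 / Suc k) * (V - 1 / Suc k)) \<longlonglongrightarrow> V"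
    by simp
  have "(\<lambda>k. EU u i \<theta> (canon u f (c(i := (\<theta>, k))))) \<longlonglongrightarrow> V"
  proof (rule tendsto_sandwich[OF _ _ lim tendsto_const])
    show "\<forall>\<^sub>F k in sequentially. 1 / Suc k * R + (1 - 1 / Suc k) * (V - 1 / Suc k)
        \<le> EU u i \<theta> (canon u f (c(i := (\<theta>, k))))"
      using eventually_gt_at_top[of N] by eventually_elim (rule lower)
    show "\<forall>\<^sub>F k in sequentially. EU u i \<theta> (canon u f (c(i := (\<theta>, k)))) \<le> V"
      by (intro always_eventually allI upper)
  qed
  then show ?thesis by (simp add: V_def A_def)
qed

lemma canon_optimal:
  assumes opt: "\<And>i y. y \<in> choices u f i c \<Longrightarrow> EU u i \<theta> y \<le> EU u i \<theta> (canon u f c)"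
  shows "canon u f c = return_pmf (f \<theta>)"
proof (cases "\<exists>\<eta>. c = (\<lambda>_. (\<eta>, 0))")
  case True
  then obtain \<eta> where \<eta>: "c = (\<lambda>_. (\<eta>, 0))" ..
  then have "agree i \<eta> c" for i by (simp add: agree_def)
  then have "hatL_Y u f i (f \<eta>) \<eta> \<subseteq> lower_Y u i (return_pmf (f \<eta>)) \<theta>" for i
    using opt[of _ i] choices_agree[of i \<eta> c] \<eta> by (auto simp: lower_Y_def canon_consensus)
  then show ?thesis
    using monotone \<eta> unfolding hatLY_monotone_def by (metis canon_consensus)
next
  case False
  define i where "i = winner c"
  define A where "A = choices u f i c"
  define r where "r = centre u f i A"
  define p where "p = 1 / real (Suc (snd (c i)))"
  define b where "b = near_best u i A (c i)"
  have p: "0 < p" "p \<le> 1" by (auto simp: p_def)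
  have canon: "canon u f c = mix p r b"
    using False by (simp add: canon_def pick_def i_def A_def r_def p_def b_def)
  have b: "b \<in> A"
    unfolding b_def A_def by (intro near_best choices_nonempty)
  have r: "is_centre u f i A r"
    unfolding r_def A_def by (rule is_centre_centre)
  \<comment> \<open>Since \<open>b\<close> is worth no more than the optimal mixture, the component
    \<open>r\<close>, having positive weight, is worth at least as much as the mixture.\<close>
  have "EU u i \<theta> y \<le> EU u i \<theta> r" if "y \<in> A" for y
  proof -
    have "EU u i \<theta> (canon u f c) = p * EU u i \<theta> r + (1 - p) * EU u i \<theta> b"
      using p by (simp add: canon EU_mix)
    moreover have "(1 - p) * EU u i \<theta> b \<le> (1 - p) * EU u i \<theta> (canon u f c)"
      using p opt[of b i] b by (intro mult_left_mono) (auto simp: A_def)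
    ultimately have "p * EU u i \<theta> (canon u f c) \<le> p * EU u i \<theta> r"
      by (simp add: algebra_simps)
    then show ?thesis
      using p opt[of y i] that by (auto simp: A_def)
  qed
  \<comment> \<open>A non-winner may choose any lottery, so the outcome is his global optimum; its
    whole support, which contains that of \<open>r\<close>, is then top for him.\<close>
  moreover have "set_pmf r \<subseteq> argmax_on (u j \<theta>) UNIV" if "j \<noteq> i" for j
  proof -
    have "choices u f j c = UNIV"
      using winner_agree False that by (auto simp: choices_def i_def)
    then have top: "u j \<theta> z \<le> EU u j \<theta> (canon u f c)" for z
      using opt[of "return_pmf z" j] by simp
    have "u j \<theta> z = EU u j \<theta> (canon u f c)" if "z \<in> set_pmf r" for z
      using top set_pmf_mix[OF p, of r b] that
      by (intro EU_upper_bound_attained[of "canon u f c"]) (auto simp: canon)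
    then show ?thesis
      using top by (auto simp: argmax_on_def)
  qed
  ultimately have "A = {return_pmf (f \<theta>)}"
    using r by (auto simp: is_centre_def)
  then show ?thesis
    using canon_in_choices[of c i] by (simp add: A_def)
qed

end

section \<open>Mixed deviations\<close>

text \<open>A profile drawn from \<open>\<sigma>\<close> has coordinate \<open>i\<close>
  overwritten, so the draw from \<open>\<sigma> i\<close> is irrelevant. Deviations can thus be
  evaluated under the original distribution.\<close>

lemma Pi_pmf_fun_upd:
  fixes \<sigma> :: "'i::finite \<Rightarrow> 'a pmf"
  shows "Pi_pmf UNIV d (\<sigma>(i := \<tau>)) = bind_pmf (Pi_pmf UNIV d \<sigma>) (\<lambda>m. map_pmf (\<lambda>x. m(i := x)) \<tau>)"
proof -
  have UN: "(UNIV :: 'i set) = insert i (UNIV - {i})" by auto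
  have split: "Pi_pmf UNIV d s =
      bind_pmf (s i) (\<lambda>x. map_pmf (\<lambda>m. m(i := x)) (Pi_pmf (UNIV - {i}) d s))" for s :: "'i \<Rightarrow> 'a pmf"
    by (subst UN, subst Pi_pmf_insert) (auto simp: pair_pmf_def map_bind_pmf map_pmf_def bind_assoc_pmf bind_return_pmf)
  have cong: "Pi_pmf (UNIV - {i}) d (\<sigma>(i := \<tau>)) = Pi_pmf (UNIV - {i}) d \<sigma>"
    by (intro Pi_pmf_cong) auto
  show ?thesis
    unfolding split[of "\<sigma>(i := \<tau>)"] split[of \<sigma>] cong
    by (simp add: map_pmf_def bind_assoc_pmf bind_return_pmf)
       (subst bind_commute_pmf, simp)
qed

lemma outcome_fun_upd:
  fixes g :: "('i::finite \<Rightarrow> nat) \<Rightarrow> 'z pmf"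
  shows "outcome g (\<sigma>(i := \<tau>)) = bind_pmf (Pi_pmf UNIV 0 \<sigma>) (\<lambda>m. bind_pmf \<tau> (\<lambda>x. g (m(i := x))))"
  by (simp add: outcome_def Pi_pmf_fun_upd map_pmf_def bind_assoc_pmf bind_return_pmf)

lemma outcome_pure: "outcome g (\<lambda>i. return_pmf (m i)) = g m"
  by (simp add: outcome_def Pi_pmf_return_pmf bind_return_pmf)

text \<open>Against pure opponents a mixed deviation pays an average of pure deviation
  payoffs.\<close>

lemma PNE_imp_MNE:
  fixes u :: "'i::finite \<Rightarrow> 'th \<Rightarrow> 'z::finite \<Rightarrow> real"
  assumes "m \<in> PNE u M g \<theta>"
  shows "(\<lambda>i. return_pmf (m i)) \<in> MNE u M g \<theta>"
proof -
  have "EU u i \<theta> (outcome g ((\<lambda>i. return_pmf (m i))(i := \<tau>))) \<le> EU u i \<theta> (g m)"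
    if \<tau>: "set_pmf \<tau> \<subseteq> M i" for i \<tau>
  proof -
    have "EU u i \<theta> (outcome g ((\<lambda>i. return_pmf (m i))(i := \<tau>)))
        = measure_pmf.expectation \<tau> (\<lambda>x. EU u i \<theta> (g (m(i := x))))"
      by (simp add: outcome_fun_upd Pi_pmf_return_pmf bind_return_pmf EU_bind)
    also have "\<dots> \<le> measure_pmf.expectation \<tau> (\<lambda>_. EU u i \<theta> (g m))"
      using assms \<tau> by (intro integral_mono_AE integrable_EU) (auto simp: AE_measure_pmf_iff PNE_def)
    finally show ?thesis by simp
  qed
  then show ?thesis
    using assms by (auto simp: MNE_def PNE_def mixed_profile_def pure_profile_def outcome_pure)
qed

section \<open>Equilibria of the mechanism\<close>

context monotone_scf
begin

text \<open>Countability of the states allows messages to be coded by naturals;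
  \<open>from_nat\<close> is total, so each message space can be \<open>UNIV\<close>.\<close>

definition mech :: "('i \<Rightarrow> nat) \<Rightarrow> 'z pmf" where
  "mech m = canon u f (\<lambda>i. from_nat (m i))"

text \<open>A lone deviator still faces agreement on the true state, which confines him to his lower
  contour set.\<close>

lemma truthful_PNE: "(\<lambda>_. to_nat (\<theta>, 0 :: nat)) \<in> PNE u (\<lambda>_. UNIV) mech \<theta>"
proof -
  let ?c = "\<lambda>_ :: 'i. (\<theta>, 0 :: nat)"
  have "EU u i \<theta> (mech ((\<lambda>_. to_nat (\<theta>, 0 :: nat))(i := x))) \<le> u i \<theta> (f \<theta>)" for i x
  proof -
    have upd: "(\<lambda>j. from_nat (((\<lambda>_. to_nat (\<theta>, 0 :: nat))(i := x)) j)) = ?c(i := from_nat x)"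
      by (auto simp: fun_eq_iff)
    have "agree i \<theta> (?c(i := from_nat x))"
      by (simp add: agree_def)
    then have "canon u f (?c(i := from_nat x)) \<in> lower_Y u i (return_pmf (f \<theta>)) \<theta>"
      using canon_in_choices[of "?c(i := from_nat x)" i] choices_agree hatL_Y_subset_lower_Y by fast
    then show ?thesis
      unfolding mech_def upd by (simp add: lower_Y_def)
  qed
  moreover have "mech (\<lambda>_. to_nat (\<theta>, 0 :: nat)) = return_pmf (f \<theta>)"
    by (simp add: mech_def canon_consensus)
  ultimately show ?thesis
    by (auto simp: PNE_def pure_profile_def)
qed

text \<open>By \<open>canon_in_choices\<close> the best value over \<open>choices\<close> bounds the payoff at each profile; by dominated
  convergence arbitrarily high bids attain it on average. So in equilibrium every profile in the
  support must already give each agent his best value.\<close>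

lemma MNE_support:
  assumes \<sigma>: "\<sigma> \<in> MNE u (\<lambda>_. UNIV) mech \<theta>" and m: "m \<in> set_pmf (Pi_pmf UNIV 0 \<sigma>)"
  shows "mech m = return_pmf (f \<theta>)"
  unfolding mech_def
proof (rule canon_optimal)
  fix i y
  define P where "P = Pi_pmf UNIV 0 \<sigma>"
  define c where "c = (\<lambda>m (i :: 'i). from_nat (m i :: nat) :: 'th \<times> nat)"
  define V where "V = (\<lambda>m. best_value u i \<theta> (choices u f i (c m)))"
  define W where "W = (\<lambda>k m. EU u i \<theta> (canon u f ((c m)(i := (\<theta>, k)))))"
  have V_int: "integrable (measure_pmf P) V"
    unfolding V_def by (rule integrable_bounded_pmf[OF best_value_bounded[OF choices_nonempty]])
  \<comment> \<open>Agent \<open>i\<close> deviates to the pure message that reports the true state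
    with bid \<open>k\<close>.\<close>
  have dev: "measure_pmf.expectation P (W k) \<le> measure_pmf.expectation P (\<lambda>m. EU u i \<theta> (mech m))" for k
  proof -
    have upd: "c (m(i := to_nat (\<theta>, k))) = (c m)(i := (\<theta>, k))" for m
      by (auto simp: c_def fun_eq_iff)
    have "EU u i \<theta> (outcome mech (\<sigma>(i := return_pmf (to_nat (\<theta>, k))))) \<le> EU u i \<theta> (outcome mech \<sigma>)"
      using \<sigma> by (auto simp: MNE_def)
    moreover have "mech m = canon u f (c m)" for m
      by (simp add: mech_def c_def)
    ultimately show ?thesis
      by (simp add: outcome_fun_upd bind_return_pmf upd)
        (simp add: outcome_def EU_bind P_def W_def)
  qed
  have "(\<lambda>k. measure_pmf.expectation P (W k)) \<longlonglongrightarrow> measure_pmf.expectation P V"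
  proof (rule integral_dominated_convergence)
    show "AE m in measure_pmf P. (\<lambda>k. W k m) \<longlonglongrightarrow> V m"
      unfolding W_def V_def by (intro AE_I2 canon_high_bid_tendsto)
    show "AE m in measure_pmf P. norm (W k m) \<le> (\<Sum>z\<in>UNIV. \<bar>u i \<theta> z\<bar>)" for k
      unfolding W_def by (intro AE_I2) (simp only: real_norm_def EU_bounded)
  qed auto
  then have "measure_pmf.expectation P V \<le> measure_pmf.expectation P (\<lambda>m. EU u i \<theta> (mech m))"
    using dev by (intro LIMSEQ_le_const2) auto
  moreover have "EU u i \<theta> (mech m) \<le> V m" for m
    unfolding V_def c_def mech_def by (intro EU_le_best_value canon_in_choices)
  ultimately have "EU u i \<theta> (mech m) = V m"
    using m V_int
    by (intro expectation_eq_imp_eq[of P "\<lambda>m. EU u i \<theta> (mech m)" V]) (auto simp: P_def intro: integrable_EU)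
  moreover assume "y \<in> choices u f i (\<lambda>i. from_nat (m i))"
  then have "EU u i \<theta> y \<le> V m"
    unfolding V_def c_def by (rule EU_le_best_value)
  ultimately show "EU u i \<theta> y \<le> EU u i \<theta> (canon u f (\<lambda>i. from_nat (m i)))"
    by (simp add: mech_def)
qed

lemma double_implementable: "double_Nash_implementable u f"
proof -
  have mixed: "set_pmf (outcome mech \<sigma>) = {f \<theta>}" if "\<sigma> \<in> MNE u (\<lambda>_. UNIV) mech \<theta>" for \<sigma> \<theta>
    using MNE_support[OF that] by (simp add: outcome_def set_pmf_not_empty)
  then have pure: "set_pmf (mech m) = {f \<theta>}" if "m \<in> PNE u (\<lambda>_. UNIV) mech \<theta>" for m \<theta>
    using PNE_imp_MNE[OF that] outcome_pure by metis
  have "(\<Union>\<sigma>\<in>MNE u (\<lambda>_. UNIV) mech \<theta>. set_pmf (outcome mech \<sigma>)) = {f \<theta>}"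
    and "(\<Union>m\<in>PNE u (\<lambda>_. UNIV) mech \<theta>. set_pmf (mech m)) = {f \<theta>}" for \<theta>
    \<comment> \<open>The truthful profile makes both unions nonempty.\<close>
    using mixed[of _ \<theta>] pure[of _ \<theta>] truthful_PNE[of \<theta>] PNE_imp_MNE[OF truthful_PNE, of \<theta>] by auto
  then show ?thesis
    unfolding double_Nash_implementable_def by blast
qed

end

theorem theorem2:
  fixes u :: "'i::finite \<Rightarrow> 'th::countable \<Rightarrow> 'z::finite \<Rightarrow> real"
    and f :: "'th \<Rightarrow> 'z"
  assumes "CARD('i) \<ge> 3"
    and "card (range f) \<ge> 2"
  shows "(pure_Nash_implementable u f \<longleftrightarrow> mixed_Nash_implementable u f)
       \<and> (mixed_Nash_implementable u f \<longleftrightarrow> double_Nash_implementable u f)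
       \<and> (double_Nash_implementable u f \<longleftrightarrow> hatLY_monotone u f)"
proof -
  have "hatLY_monotone u f" if "pure_Nash_implementable u f"
    using that unfolding pure_Nash_implementable_def PNE_eq_nash
    by (auto intro: nash_implementation_imp_monotone)
  moreover have "hatLY_monotone u f" if "mixed_Nash_implementable u f"
    using that unfolding mixed_Nash_implementable_def MNE_eq_nash
    by (auto intro: nash_implementation_imp_monotone)
  moreover have "double_Nash_implementable u f" if "hatLY_monotone u f"
  proof -
    interpret monotone_scf u f
      using assms that by unfold_locales
    show ?thesis by (rule double_implementable)
  qed
  moreover have "pure_Nash_implementable u f" "mixed_Nash_implementable u f"
    if "double_Nash_implementable u f"
    using that unfolding double_Nash_implementable_def pure_Nash_implementable_def
      mixed_Nash_implementable_def by blast+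
  ultimately show ?thesis by blast
qed

end
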